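(* If $\diamond$ is commutative and associative, then the space $\mathcal{R}\langle L\rangle$ equipped with $\hat{\mathbin{\sqcup\!\sqcup}}$ becomes a commutative $\mathcal{R}$-algebra.
   Context: Let $\mathcal{R}$ be a commutative ring with unit containing $\mathbb{Q}$, $L$ a set (of letters), and $\mathcal{R}\langle L\rangle$ the non-commutative polynomial ring in $L$; monic monomials are words, ${\bf 1}$ is the empty word. Let $F$ be the $\mathcal{R}$-linear map sending a word to its first letter (and ${\bf 1}\mapsto{\bf 1}$), and $R$ the map sending a linear combination of words to the sum (after collecting like terms, coefficients dropped) of the words with first letter removed, with $R(c\alpha)=R(c{\bf 1})={\bf 1}$. Let $\diamond:\mathcal{R}L\times\mathcal{R}L\to\mathcal{R}\langle L\rangle$ be $\mathcal{R}$-bilinear; $l(\alpha,\beta)$ denotes the length of $\alpha\diamond\beta$. $\diamond$ is commutative if $\alpha\diamond\beta=\beta\diamond\alpha$ for all $\alpha,\beta\in L$; decomposable if there is a word $w$ with $R(\alpha\diamond\beta)=w$ whenever $R(\alpha\diamond\beta)\notin\mathcal{R}L$; a decomposable $\diamond$ is associative if $(F(\alpha\diamond\beta)\diamond\gamma)R(\alpha\diamond\beta)=(\alpha\diamond F(\beta\diamond\gamma))R(\beta\diamond\gamma)$ for all $\alpha,\beta,\gamma\in L$ and $\gamma\diamond F(R(\alpha\diamond\beta))=-\gamma F(R(\alpha\diamond\beta))$ for all $\gamma\in L$ and $\alpha,\beta\in L$ with $l(\alpha,\beta)\ge2$. The generalized quasi-shuffle product $\hat{\mathbin{\sqcup\!\sqcup}}$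 associated to $\diamond$ is defined for non-empty words $x,y$ by $x\hat{\mathbin{\sqcup\!\sqcup}} y=F(x)(R(x)\hat{\mathbin{\sqcup\!\sqcup}} y)+F(y)(x\hat{\mathbin{\sqcup\!\sqcup}} R(y))+(F(x)\diamond F(y))(R(x)\hat{\mathbin{\sqcup\!\sqcup}} R(y))$ and ${\bf 1}\hat{\mathbin{\sqcup\!\sqcup}} x=x\hat{\mathbin{\sqcup\!\sqcup}}{\bf 1}=x$, extended bilinearly. *)

theory Defs
  imports Complex_Main "HOL-Library.Poly_Mapping"
begin

text \<open>
  Words over the letters \<open>'l\<close> are lists. Making lists a monoid under concatenation turns
  \<open>'l list \<Rightarrow>\<^sub>0 'r\<close>, with the convolution product of \<open>Poly_Mapping\<close>, into the ring of
  non-commutative polynomials; its unit is the empty word.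
\<close>

instantiation list :: (type) monoid_add
begin

definition zero_list :: "'a list" where "zero_list = []"

definition plus_list :: "'a list \<Rightarrow> 'a list \<Rightarrow> 'a list" where "plus_list xs ys = xs @ ys"

instance by standard (simp_all add: zero_list_def plus_list_def)

end

type_synonym ('l, 'r) ncpoly = "'l list \<Rightarrow>\<^sub>0 'r"

definition rat_embedding :: "(rat \<Rightarrow> 'r::comm_ring_1) \<Rightarrow> bool" where
  "rat_embedding \<iota> \<longleftrightarrow> inj \<iota> \<and> \<iota> 1 = 1 \<and>
     (\<forall>x y. \<iota> (x + y) = \<iota> x + \<iota> y) \<and> (\<forall>x y. \<iota> (x * y) = \<iota> x * \<iota> y)"

definition word :: "'l list \<Rightarrow> ('l, 'r::comm_ring_1) ncpoly" where
  "word w = Poly_Mapping.single w 1"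

abbreviation letter :: "'l \<Rightarrow> ('l, 'r::comm_ring_1) ncpoly" where
  "letter \<alpha> \<equiv> word [\<alpha>]"

definition scale :: "'r::comm_ring_1 \<Rightarrow> ('l, 'r) ncpoly \<Rightarrow> ('l, 'r) ncpoly" where
  "scale c p = Poly_Mapping.single [] c * p"

text \<open>The submodule spanned by the letters.\<close>

definition letter_span :: "('l, 'r::comm_ring_1) ncpoly set" where
  "letter_span = {p. \<forall>w \<in> Poly_Mapping.keys p. length w = 1}"

text \<open>Note that \<open>take 1 [] = []\<close>, so the empty word is sent to itself.\<close>

definition first_letter :: "('l, 'r::comm_ring_1) ncpoly \<Rightarrow> ('l, 'r) ncpoly" where
  "first_letter p =
     (\<Sum>w \<in> Poly_Mapping.keys p. scale (Poly_Mapping.lookup p w) (word (take 1 w)))"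

text \<open>
  The words occurring in \<open>p\<close> (with non-zero coefficient) lose their first letter; each word so
  obtained is counted once, with coefficient 1, however many words of \<open>p\<close> it comes from.
  For instance \<open>ab + 2cb\<close> is sent to \<open>b\<close>. Since \<open>drop 1 [] = []\<close>, non-zero multiples of a
  letter or of the empty word are sent to the empty word; 0 is sent to 0.
\<close>

definition remainder :: "('l, 'r::comm_ring_1) ncpoly \<Rightarrow> ('l, 'r) ncpoly" where
  "remainder p = (\<Sum>v \<in> drop 1 ` Poly_Mapping.keys p. word v)"

definition poly_length :: "('l, 'r::comm_ring_1) ncpoly \<Rightarrow> nat" where
  "poly_length p = Max (insert 0 (length ` Poly_Mapping.keys p))"

text \<open>
  The operation \<open>\<diamond>\<close> is defined on pairs of linear combinations of letters. It is represented by a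
  function on all polynomials, whose values outside \<^const>\<open>letter_span\<close> are never used.
\<close>

type_synonym ('l, 'r) diamond = "('l, 'r) ncpoly \<Rightarrow> ('l, 'r) ncpoly \<Rightarrow> ('l, 'r) ncpoly"

definition diamond_bilinear :: "('l, 'r::comm_ring_1) diamond \<Rightarrow> bool" where
  "diamond_bilinear D \<longleftrightarrow>
     (\<forall>x \<in> letter_span. \<forall>y \<in> letter_span. \<forall>z \<in> letter_span. \<forall>c.
        D (x + y) z = D x z + D y z \<and> D (scale c x) z = scale c (D x z) \<and>
        D z (x + y) = D z x + D z y \<and> D z (scale c x) = scale c (D z x))"

definition diamond_commutative :: "('l, 'r::comm_ring_1) diamond \<Rightarrow> bool" where
  "diamond_commutative D \<longleftrightarrow>
     (\<forall>\<alpha> \<beta>. D (letter \<alpha>) (letter \<beta>) = D (letter \<beta>) (letter \<alpha>))"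

definition diamond_decomposable :: "('l, 'r::comm_ring_1) diamond \<Rightarrow> bool" where
  "diamond_decomposable D \<longleftrightarrow>
     (\<forall>\<alpha> \<beta>. remainder (D (letter \<alpha>) (letter \<beta>)) \<notin> letter_span \<longrightarrow>
        (\<exists>w. remainder (D (letter \<alpha>) (letter \<beta>)) = word w))"

text \<open>
  The second conjunct says that the terms \<open>F(\<alpha> \<diamond> \<beta>) \<diamond> \<gamma>\<close> and \<open>\<alpha> \<diamond> F(\<beta> \<diamond> \<gamma>)\<close> of the associativity
  equation are meaningful, i.e. that the arguments of \<open>\<diamond>\<close> are linear combinations of letters;
  equivalently, no \<open>\<alpha> \<diamond> \<beta>\<close> has a constant term. In the last conjunct this is automatic.
\<close>

definition diamond_associative :: "('l, 'r::comm_ring_1) diamond \<Rightarrow> bool" where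
  "diamond_associative D \<longleftrightarrow>
     diamond_decomposable D \<and>
     (\<forall>\<alpha> \<beta>. first_letter (D (letter \<alpha>) (letter \<beta>)) \<in> letter_span) \<and>
     (\<forall>\<alpha> \<beta> \<gamma>.
        D (first_letter (D (letter \<alpha>) (letter \<beta>))) (letter \<gamma>) *
          remainder (D (letter \<alpha>) (letter \<beta>)) =
        D (letter \<alpha>) (first_letter (D (letter \<beta>) (letter \<gamma>))) *
          remainder (D (letter \<beta>) (letter \<gamma>))) \<and>
     (\<forall>\<alpha> \<beta> \<gamma>. poly_length (D (letter \<alpha>) (letter \<beta>)) \<ge> 2 \<longrightarrow>
        D (letter \<gamma>) (first_letter (remainder (D (letter \<alpha>) (letter \<beta>)))) =
        - (letter \<gamma> * first_letter (remainder (D (letter \<alpha>) (letter \<beta>)))))"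

fun qsh_words :: "('l, 'r::comm_ring_1) diamond \<Rightarrow> 'l list \<Rightarrow> 'l list \<Rightarrow> ('l, 'r) ncpoly" where
  "qsh_words D [] y = word y"
| "qsh_words D x [] = word x"
| "qsh_words D (\<alpha> # x) (\<beta> # y) =
     letter \<alpha> * qsh_words D x (\<beta> # y) + letter \<beta> * qsh_words D (\<alpha> # x) y +
     D (letter \<alpha>) (letter \<beta>) * qsh_words D x y"

definition qsh :: "('l, 'r::comm_ring_1) diamond \<Rightarrow>
    ('l, 'r) ncpoly \<Rightarrow> ('l, 'r) ncpoly \<Rightarrow> ('l, 'r) ncpoly" where
  "qsh D p q = (\<Sum>x \<in> Poly_Mapping.keys p. \<Sum>y \<in> Poly_Mapping.keys q.
     scale (Poly_Mapping.lookup p x * Poly_Mapping.lookup q y) (qsh_words D x y))"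

text \<open>Commutative, associative, unital algebras over a commutative ring.\<close>

locale commutative_algebra = module scl + comm_monoid mlt unt
  for scl :: "'r::comm_ring_1 \<Rightarrow> 'm::ab_group_add \<Rightarrow> 'm"
    and mlt :: "'m \<Rightarrow> 'm \<Rightarrow> 'm" and unt :: 'm +
  assumes mlt_add_left: "mlt (x + y) z = mlt x z + mlt y z"
    and mlt_scale_left: "mlt (scl c x) z = scl c (mlt x z)"

end

theory Submission
  imports Defs
begin

text \<open>
  Commutativity of the product is immediate from the recursion. For associativity one needs
  \<open>\<alpha> \<diamond> \<beta> = f(\<alpha>,\<beta>) R(\<alpha> \<diamond> \<beta>)\<close> with \<open>f(\<alpha>,\<beta>)\<close> a combination of letters, and that left factors
  \<open>R(\<alpha> \<diamond> \<beta>)\<close> can be pulled out of the product; then the expansions of \<open>(x \<cdot> y) \<cdot> z\<close> and of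
  \<open>(z \<cdot> y) \<cdot> x\<close> agree by induction on the total length.

  Both facts come from the last condition in the definition of associativity. It says that
  \<open>u = F(R(\<alpha> \<diamond> \<beta>))\<close> satisfies \<open>\<gamma> \<diamond> u = - \<gamma> u\<close> for all letters \<open>\<gamma>\<close>, whence
  \<open>(u p) \<cdot> q = u (p \<cdot> q)\<close>. By commutativity of \<open>\<diamond>\<close> the same \<open>u\<close> arises from all \<open>\<alpha> \<diamond> \<beta>\<close> of
  length at least 2. If \<open>u\<close> is a single letter, the associativity equation for \<open>\<alpha>, \<beta>, u\<close> shows that
  \<open>R(\<alpha> \<diamond> \<beta>)\<close> commutes with \<open>u\<close>, hence is a power of \<open>u\<close>, and \<open>f(\<alpha>,\<beta>) = F(\<alpha> \<diamond> \<beta>)\<close>. If \<open>u\<close> is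
  a sum of \<open>m \<ge> 2\<close> letters, summing the associativity equations over these letters yields
  \<open>F(\<alpha> \<diamond> \<beta>) u = m (\<alpha> \<diamond> \<beta>)\<close>, so that \<open>f(\<alpha>,\<beta>) = F(\<alpha> \<diamond> \<beta>) / m\<close>;
  this is where the rationals are needed.
\<close>

section \<open>Non-commutative polynomials as a module spanned by the words\<close>

lemma scale_conv_map: "scale c p = Poly_Mapping.map ((*) c) p"
  unfolding scale_def by (metis mult_map_scale_conv_mult zero_list_def)

lemma lookup_scale [simp]:
  "Poly_Mapping.lookup (scale c p) w = c * Poly_Mapping.lookup p w"
  by (simp add: scale_conv_map map.rep_eq when_def)

interpretation scale: module scale
  by standard (auto intro!: poly_mapping_eqI simp: lookup_add algebra_simps)

lemma scale_mult_left: "scale c p * q = scale c (p * q)"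
  by (simp add: scale_def mult.assoc)

lemma lookup_word: "Poly_Mapping.lookup (word v) w = (1 when v = w)"
  by (simp add: word_def lookup_single)

lemma word_append: "word (v @ w) = word v * word w"
  by (simp add: word_def mult_single plus_list_def)

lemma word_Nil [simp]: "word [] = 1"
  by (auto intro!: poly_mapping_eqI simp: lookup_word lookup_one zero_list_def when_def)

lemma word_Cons: "word (a # w) = letter a * word w"
  using word_append[of "[a]" w] by simp

lemma keys_word [simp]: "Poly_Mapping.keys (word w :: ('l, 'r::comm_ring_1) ncpoly) = {w}"
  by (simp add: word_def)

text \<open>Both \<open>first_letter\<close> and, in each argument, \<open>qsh\<close> are of this
  form, so their linearity reduces to that of \<open>linear_extension\<close>.\<close>

definition linear_extension ::
    "('l list \<Rightarrow> ('l, 'r::comm_ring_1) ncpoly) \<Rightarrow> ('l, 'r) ncpoly \<Rightarrow> ('l, 'r) ncpoly" where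
  "linear_extension g p = (\<Sum>w \<in> Poly_Mapping.keys p. scale (Poly_Mapping.lookup p w) (g w))"

lemma linear_extension_superset:
  assumes "finite K" "Poly_Mapping.keys p \<subseteq> K"
  shows "linear_extension g p = (\<Sum>w \<in> K. scale (Poly_Mapping.lookup p w) (g w))"
  unfolding linear_extension_def
  by (rule sum.mono_neutral_left) (use assms in \<open>auto simp: in_keys_iff\<close>)

lemma linear_extension_add:
  "linear_extension g (p + q) = linear_extension g p + linear_extension g q"
proof -
  let ?K = "Poly_Mapping.keys p \<union> Poly_Mapping.keys q"
  have "linear_extension g r = (\<Sum>w \<in> ?K. scale (Poly_Mapping.lookup r w) (g w))"
    if "r \<in> {p, q, p + q}" for r
    using that keys_add[of p q] by (intro linear_extension_superset) auto
  then show ?thesis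
    by (simp add: lookup_add scale.scale_left_distrib sum.distrib)
qed

lemma linear_extension_scale:
  "linear_extension g (scale c p) = scale c (linear_extension g p)"
proof -
  have "linear_extension g (scale c p) =
      (\<Sum>w \<in> Poly_Mapping.keys p. scale (Poly_Mapping.lookup (scale c p) w) (g w))"
    by (intro linear_extension_superset) (auto simp: in_keys_iff)
  then show ?thesis
    by (simp add: linear_extension_def scale.scale_sum_right)
qed

lemma linear_extension_0 [simp]: "linear_extension g 0 = 0"
  by (simp add: linear_extension_def)

lemma linear_extension_word [simp]: "linear_extension g (word w) = g w"
  by (simp add: linear_extension_def lookup_word)

lemma linear_extension_uminus: "linear_extension g (- p) = - linear_extension g p"
  using linear_extension_add[of g p "- p"] by (simp add: eq_neg_iff_add_eq_0 add.commute)

lemma linear_extension_sum: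
  "linear_extension g (\<Sum>i \<in> A. h i) = (\<Sum>i \<in> A. linear_extension g (h i))"
  by (induction A rule: infinite_finite_induct) (auto simp: linear_extension_add)

lemma linear_extension_word_id: "linear_extension word p = p"
proof (rule poly_mapping_eqI)
  fix w
  have "Poly_Mapping.lookup (linear_extension word p) w =
      (\<Sum>v \<in> Poly_Mapping.keys p. Poly_Mapping.lookup p v * (1 when v = w))"
    by (simp add: linear_extension_def lookup_sum lookup_word)
  also have "\<dots> = (\<Sum>v \<in> Poly_Mapping.keys p. if v = w then Poly_Mapping.lookup p v else 0)"
    by (intro sum.cong) auto
  also have "\<dots> = Poly_Mapping.lookup p w"
    by (simp add: in_keys_iff)
  finally show "Poly_Mapping.lookup (linear_extension word p) w = Poly_Mapping.lookup p w" .
qed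

text \<open>Only words occurring in \<open>p\<close> have to be treated, which makes the rule usable
  for polynomials of restricted support, such as those in \<open>letter_span\<close>.\<close>

lemma ncpoly_span_induct:
  assumes "\<And>w. w \<in> Poly_Mapping.keys p \<Longrightarrow> P (word w)"
    and "P 0" and "\<And>p q. P p \<Longrightarrow> P q \<Longrightarrow> P (p + q)" and "\<And>c p. P p \<Longrightarrow> P (scale c p)"
  shows "P p"
proof -
  have "P (\<Sum>w \<in> K. scale (Poly_Mapping.lookup p w) (word w))"
    if "finite K" "K \<subseteq> Poly_Mapping.keys p" for K
    using that by (induction K) (auto intro: assms)
  from this[of "Poly_Mapping.keys p"] show ?thesis
    using linear_extension_word_id[of p] by (simp add: linear_extension_def)
qed

lemma ncpoly_induct [case_names word add scale]:
  assumes "\<And>w. P (word w)" and "\<And>p q. P p \<Longrightarrow> P q \<Longrightarrow> P (p + q)"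
    and "\<And>c p. P p \<Longrightarrow> P (scale c p)"
  shows "P p"
  using assms(3)[OF assms(1), of 0] by (intro ncpoly_span_induct[of p P] assms) simp_all

text \<open>Scalars act as constant polynomials from the left. They are central because the empty
  word is neutral for concatenation and the coefficient ring is commutative.\<close>

lemma scale_mult_right: "p * scale c q = scale c (p * q)"
proof (induction p rule: ncpoly_induct)
  case (word w)
  then show ?case
    by (simp add: scale_def word_def mult_single plus_list_def flip: mult.assoc)
next
  case (add p p')
  then show ?case by (simp add: algebra_simps)
next
  case (scale d p)
  then show ?case by (simp add: scale_mult_left mult.commute)
qed

section \<open>The span of the letters, and coefficients of products with its elements\<close>

lemma letter_span_iff:
  "p \<in> letter_span \<longleftrightarrow> (\<forall>w. length w \<noteq> 1 \<longrightarrow> Poly_Mapping.lookup p w = 0)"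
  by (auto simp: letter_span_def in_keys_iff)

lemma letter_span_closed:
  "letter a \<in> letter_span" "0 \<in> letter_span"
  "p \<in> letter_span \<Longrightarrow> q \<in> letter_span \<Longrightarrow> p + q \<in> letter_span"
  "p \<in> letter_span \<Longrightarrow> scale c p \<in> letter_span"
  "p \<in> letter_span \<Longrightarrow> - p \<in> letter_span"
  by (auto simp: letter_span_iff lookup_word lookup_add when_def)

lemma letter_span_sum: "(\<And>i. i \<in> A \<Longrightarrow> h i \<in> letter_span) \<Longrightarrow> (\<Sum>i \<in> A. h i) \<in> letter_span"
  by (induction A rule: infinite_finite_induct) (auto intro: letter_span_closed)

lemma letter_span_induct [consumes 1, case_names letter add scale]:
  assumes "p \<in> letter_span"
    and "\<And>a. P (letter a)"
    and "\<And>p q. p \<in> letter_span \<Longrightarrow> q \<in> letter_span \<Longrightarrow> P p \<Longrightarrow> P q \<Longrightarrow> P (p + q)"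
    and "\<And>c p. p \<in> letter_span \<Longrightarrow> P p \<Longrightarrow> P (scale c p)"
  shows "P p"
proof -
  have "p \<in> letter_span \<and> P p"
  proof (rule ncpoly_span_induct[of p])
    fix w assume "w \<in> Poly_Mapping.keys p"
    then have "length w = 1" using assms(1) by (auto simp: letter_span_def)
    then show "word w \<in> letter_span \<and> P (word w)"
      using assms(2) letter_span_closed(1) by (auto simp: length_Suc_conv)
  next
    show "0 \<in> letter_span \<and> P 0"
      using assms(4)[OF letter_span_closed(1) assms(2), of 0] letter_span_closed(2) by simp
  qed (auto intro: assms letter_span_closed)
  then show ?thesis ..
qed

lemma lookup_letter_mult:
  "Poly_Mapping.lookup (letter a * q) w =
    (case w of [] \<Rightarrow> 0 | b # v \<Rightarrow> Poly_Mapping.lookup q v when a = b)"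
proof (induction q rule: ncpoly_induct)
  case (word v)
  then show ?case
    by (auto simp: lookup_word when_def split: list.splits simp flip: word_Cons)
next
  case (add p q)
  then show ?case by (auto simp: algebra_simps lookup_add when_def split: list.splits)
next
  case (scale c q)
  then show ?case by (auto simp: scale_mult_right when_def split: list.splits)
qed

lemma lookup_mult_letter:
  "Poly_Mapping.lookup (q * letter a) (w @ [b]) = (Poly_Mapping.lookup q w when a = b)"
proof (induction q rule: ncpoly_induct)
  case (word v)
  then show ?case
    by (auto simp: lookup_word when_def simp flip: word_append)
next
  case (add p q)
  then show ?case by (auto simp: algebra_simps lookup_add when_def)
next
  case (scale c q)
  then show ?case by (auto simp: scale_mult_left when_def)
qed

text \<open>A non-empty word splits in only one way into a first letter and a rest, so the
  convolution has a single term.\<close>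

lemma lookup_letter_span_mult:
  assumes "f \<in> letter_span"
  shows "Poly_Mapping.lookup (f * q) w =
    (case w of [] \<Rightarrow> 0 | b # v \<Rightarrow> Poly_Mapping.lookup f [b] * Poly_Mapping.lookup q v)"
  using assms
  by (induction f rule: letter_span_induct)
    (auto simp: lookup_letter_mult lookup_word when_def algebra_simps lookup_add scale_mult_left
      split: list.splits)

lemma lookup_mult_letter_span:
  assumes "f \<in> letter_span"
  shows "Poly_Mapping.lookup (q * f) (w @ [b]) =
    Poly_Mapping.lookup q w * Poly_Mapping.lookup f [b]"
  using assms
  by (induction f rule: letter_span_induct)
    (auto simp: lookup_mult_letter lookup_word when_def algebra_simps lookup_add scale_mult_right)

section \<open>First letters and remainders\<close>

lemma first_letter_conv_linear_extension:
  "first_letter = linear_extension (\<lambda>w. word (take 1 w))"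
  by (simp add: first_letter_def linear_extension_def fun_eq_iff)

lemma lookup_first_letter_Nil:
  "Poly_Mapping.lookup (first_letter p) [] = Poly_Mapping.lookup p []"
  unfolding first_letter_conv_linear_extension
  by (induction p rule: ncpoly_induct)
    (auto simp: linear_extension_add linear_extension_scale lookup_add lookup_word when_def)

lemma first_letter_letter_span: "p \<in> letter_span \<Longrightarrow> first_letter p = p"
  unfolding first_letter_conv_linear_extension
  by (induction p rule: letter_span_induct)
    (auto simp: linear_extension_add linear_extension_scale)

lemma first_letter_letter_mult:
  "first_letter (letter a * letter b) = (letter a :: ('l, 'r::comm_ring_1) ncpoly)"
  by (simp add: first_letter_conv_linear_extension flip: word_append)

lemma keys_remainder: "Poly_Mapping.keys (remainder p) = drop 1 ` Poly_Mapping.keys p"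
proof -
  have "Poly_Mapping.lookup (remainder p) w = (if w \<in> drop 1 ` Poly_Mapping.keys p then 1 else 0)" for w
    by (simp add: remainder_def lookup_sum lookup_word when_def)
  then show ?thesis
    by (intro set_eqI) (simp add: in_keys_iff[of _ "remainder p"])
qed

lemma remainder_uminus: "remainder (- p) = remainder p"
proof -
  have "Poly_Mapping.keys (- p) = Poly_Mapping.keys p" by (auto simp: in_keys_iff)
  then show ?thesis by (simp add: remainder_def)
qed

lemma remainder_word [simp]: "remainder (word w) = word (drop 1 w)"
  by (simp add: remainder_def)

lemma remainder_letter_span:
  assumes "p \<in> letter_span" "p \<noteq> 0"
  shows "remainder p = 1"
proof -
  have "drop 1 ` Poly_Mapping.keys p = (\<lambda>_. []) ` Poly_Mapping.keys p"
    using assms(1) by (intro image_cong) (auto simp: letter_span_def)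
  then have "drop 1 ` Poly_Mapping.keys p = {[]}"
    using assms(2) by (simp add: image_constant_conv)
  then show ?thesis by (simp add: remainder_def)
qed

text \<open>Every word of \<open>p\<close> is a letter followed by the same \<open>w\<close>, so
  only the first letters and their coefficients vary.\<close>

lemma first_letter_mult_remainder_word:
  assumes "[] \<notin> Poly_Mapping.keys p" "remainder p = word w"
  shows "p = first_letter p * word w"
proof (rule ncpoly_span_induct[of p])
  fix v assume v: "v \<in> Poly_Mapping.keys p"
  then have "drop 1 v \<in> Poly_Mapping.keys (remainder p)" by (auto simp: keys_remainder)
  then have "drop 1 v = w" by (simp add: assms(2))
  moreover have "v \<noteq> []" using v assms(1) by auto
  ultimately obtain a where "v = a # w" by (cases v) auto
  then show "word v = first_letter (word v) * word w"
    by (simp add: first_letter_conv_linear_extension flip: word_Cons)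
qed (simp_all add: first_letter_conv_linear_extension linear_extension_add linear_extension_scale
      scale_mult_left algebra_simps)

section \<open>Sums of distinct letters\<close>

definition letter_sum :: "'l set \<Rightarrow> ('l, 'r::comm_ring_1) ncpoly" where
  "letter_sum V = (\<Sum>v \<in> V. letter v)"

lemma letter_sum_span: "letter_sum V \<in> letter_span"
  unfolding letter_sum_def by (intro letter_span_sum letter_span_closed)

lemma lookup_letter_sum:
  "finite V \<Longrightarrow> Poly_Mapping.lookup (letter_sum V) [a] = (1 when a \<in> V)"
  by (simp add: letter_sum_def lookup_sum lookup_word when_def)

text \<open>Comparing coefficients at \<open>[x, y]\<close> gives
  \<open>V \<times> W = W \<times> V\<close>, and both sets are non-empty.\<close>

lemma letter_sum_commute_imp_eq:
  assumes "finite V" "V \<noteq> {}" "finite W" "W \<noteq> {}"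
    and "letter_sum V * letter_sum W = (letter_sum W * letter_sum V :: ('l, 'r::comm_ring_1) ncpoly)"
  shows "V = W"
proof -
  have "((1::'r) when x \<in> V \<and> y \<in> W) = (1 when x \<in> W \<and> y \<in> V)" for x y
    using arg_cong[OF assms(5), of "\<lambda>p. Poly_Mapping.lookup p [x, y]"] assms(1,3)
    by (auto simp: lookup_letter_span_mult letter_sum_span lookup_letter_sum when_def split: if_splits)
  then have "x \<in> V \<and> y \<in> W \<longleftrightarrow> x \<in> W \<and> y \<in> V" for x y
    unfolding when_def by (metis zero_neq_one)
  then show ?thesis using assms(2,4) by blast
qed

text \<open>The coefficient of \<open>p\<close> at \<open>w\<close> reappears unchanged at
  \<open>w @ [v]\<close> for \<open>v \<in> V\<close>, so this cancellation works even if the ring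
  has zero divisors.\<close>

lemma mult_letter_sum_eq_0:
  assumes "finite V" "V \<noteq> {}" "p * letter_sum V = 0"
  shows "p = 0"
proof (rule poly_mapping_eqI)
  fix w
  from assms(2) obtain v where "v \<in> V" by auto
  then show "Poly_Mapping.lookup p w = Poly_Mapping.lookup 0 w"
    using lookup_mult_letter_span[OF letter_sum_span, of p V w v] assms(1,3)
    by (simp add: lookup_letter_sum)
qed

text \<open>All coefficients of a remainder are 1, so a linear remainder is determined by its set of
  letters.\<close>

lemma remainder_in_letter_span:
  fixes p :: "('l, 'r::comm_ring_1) ncpoly"
  assumes "remainder p \<in> letter_span"
  obtains V where "finite V" "remainder p = letter_sum V"
proof -
  let ?K = "drop 1 ` Poly_Mapping.keys p"
  have sing: "[hd w] = w" if "w \<in> ?K" for w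
  proof -
    have "length w = 1"
      using assms that unfolding letter_span_def mem_Collect_eq keys_remainder by blast
    then show ?thesis by (cases w) auto
  qed
  have "inj_on hd ?K"
    by (rule inj_on_inverseI[of _ "\<lambda>a. [a]"]) (rule sing)
  then have "(\<Sum>v \<in> hd ` ?K. letter v) = (\<Sum>w \<in> ?K. letter (hd w) :: ('l, 'r) ncpoly)"
    by (simp only: sum.reindex comp_def)
  also have "\<dots> = remainder p"
    unfolding remainder_def by (intro sum.cong refl) (simp only: sing)
  finally have "remainder p = (\<Sum>v \<in> hd ` ?K. letter v)" ..
  then show ?thesis
    using that[of "hd ` ?K"] by (simp add: letter_sum_def)
qed

lemma scale_of_nat: "scale (of_nat n) p = of_nat n * p"
  by (induction n) (simp_all add: algebra_simps)

text \<open>\<open>\<iota>\<close> agrees with \<open>of_nat\<close> on natural numbers, so it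
  carries \<open>1 / n\<close> to an inverse of \<open>n\<close>.\<close>

lemma rat_embedding_of_nat_inverse:
  assumes "rat_embedding \<iota>" "n > 0"
  shows "of_nat n * \<iota> (1 / of_nat n) = 1"
proof -
  have add: "\<iota> (x + y) = \<iota> x + \<iota> y" and mult: "\<iota> (x * y) = \<iota> x * \<iota> y" and one: "\<iota> 1 = 1" for x y
    using assms(1) by (auto simp: rat_embedding_def)
  have "\<iota> 0 = 0" using add[of 0 0] by simp
  then have "\<iota> (of_nat k) = of_nat k" for k by (induction k) (simp_all add: add one)
  then show ?thesis using mult[of "of_nat n" "1 / of_nat n"] assms(2) one by simp
qed

section \<open>Linearity of the product\<close>

lemma qsh_conv_linear_extension:
  "qsh D p q = linear_extension (\<lambda>x. linear_extension (qsh_words D x) q) p"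
  by (simp add: qsh_def linear_extension_def scale.scale_sum_right)

lemma qsh_word_word: "qsh D (word x) (word y) = qsh_words D x y"
  by (simp add: qsh_conv_linear_extension)

lemma qsh_add_left: "qsh D (p + q) r = qsh D p r + qsh D q r"
  by (simp add: qsh_conv_linear_extension linear_extension_add)

lemma qsh_scale_left: "qsh D (scale c p) q = scale c (qsh D p q)"
  by (simp add: qsh_conv_linear_extension linear_extension_scale)

lemma qsh_words_Nil_right [simp]: "qsh_words D x [] = word x"
  by (cases x) auto

section \<open>The product for a commutative \<open>\<diamond>\<close>\<close>

locale commutative_diamond =
  fixes D :: "('l, 'r::comm_ring_1) diamond"
  assumes bilinear: "diamond_bilinear D"
    and commutative: "diamond_commutative D"
begin

lemma add_left: "x \<in> letter_span \<Longrightarrow> y \<in> letter_span \<Longrightarrow> z \<in> letter_span \<Longrightarrow> D (x + y) z = D x z + D y z"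
  and add_right: "x \<in> letter_span \<Longrightarrow> y \<in> letter_span \<Longrightarrow> z \<in> letter_span \<Longrightarrow> D z (x + y) = D z x + D z y"
  and scale_left: "x \<in> letter_span \<Longrightarrow> z \<in> letter_span \<Longrightarrow> D (scale c x) z = scale c (D x z)"
  and scale_right: "x \<in> letter_span \<Longrightarrow> z \<in> letter_span \<Longrightarrow> D z (scale c x) = scale c (D z x)"
  using bilinear by (auto simp: diamond_bilinear_def)

lemma zero_right: "z \<in> letter_span \<Longrightarrow> D z 0 = 0"
  using scale_right[OF letter_span_closed(2), of z 0] by simp

lemma sum_right:
  assumes "z \<in> letter_span" and "\<And>i. i \<in> A \<Longrightarrow> h i \<in> letter_span"
  shows "D z (\<Sum>i \<in> A. h i) = (\<Sum>i \<in> A. D z (h i))"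
  using assms(2)
  by (induction A rule: infinite_finite_induct)
    (auto simp: add_right zero_right assms(1) letter_span_sum)

lemma letter_commute: "D (letter a) (letter b) = D (letter b) (letter a)"
  using commutative unfolding diamond_commutative_def by blast

lemma span_commute:
  assumes "x \<in> letter_span" "y \<in> letter_span"
  shows "D x y = D y x"
  using assms(1)
proof (induction x rule: letter_span_induct)
  case (letter a)
  from assms(2) show ?case
    by (induction y rule: letter_span_induct)
      (auto simp: add_left add_right scale_left scale_right letter_span_closed letter_commute)
qed (auto simp: add_left add_right scale_left scale_right assms(2))

lemma qsh_words_commute: "qsh_words D x y = qsh_words D y x"
proof (induction x arbitrary: y)
  case (Cons a x)
  note IH = Cons
  show ?case
  proof (induction y)
    case (Cons b y)
    then show ?case
      by (simp add: IH[of y] IH[of "b # y"] letter_commute[of a b] add_ac)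
  qed simp
qed simp

lemma qsh_commute: "qsh D p q = qsh D q p"
  unfolding qsh_def
  by (subst sum.swap) (simp add: mult.commute[of "Poly_Mapping.lookup p _"] qsh_words_commute)

lemma qsh_add_right: "qsh D p (q + r) = qsh D p q + qsh D p r"
  and qsh_scale_right: "qsh D p (scale c q) = scale c (qsh D p q)"
  by (simp_all add: qsh_commute[of p] qsh_add_left qsh_scale_left)

lemma qsh_one_right [simp]: "qsh D p 1 = p"
proof (induction p rule: ncpoly_induct)
  case (word w)
  then show ?case using qsh_word_word[of D w "[]"] by simp
qed (auto simp: qsh_add_left qsh_scale_left)

lemma qsh_one_left [simp]: "qsh D 1 p = p"
  by (simp add: qsh_commute[of 1 p])

text \<open>Both sides are linear in each of \<open>f\<close>, \<open>g\<close>, \<open>p\<close>,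
  \<open>q\<close>, so the defining recursion extends from letters and words, one argument at a
  time.\<close>

lemma qsh_span_mult:
  assumes "f \<in> letter_span" "g \<in> letter_span"
  shows "qsh D (f * p) (g * q) = f * qsh D p (g * q) + g * qsh D (f * p) q + D f g * qsh D p q"
proof -
  have 1: "qsh D (letter a * word x) (letter b * word y) =
    letter a * qsh D (word x) (letter b * word y) + letter b * qsh D (letter a * word x) (word y)
    + D (letter a) (letter b) * qsh D (word x) (word y)" for a b x y
    by (simp add: qsh_word_word flip: word_Cons)
  note simps = qsh_add_left qsh_add_right qsh_scale_left qsh_scale_right distrib_left distrib_right
    scale_mult_left scale_mult_right scale.scale_right_distrib
  have 2: "qsh D (letter a * word x) (letter b * q) =
    letter a * qsh D (word x) (letter b * q) + letter b * qsh D (letter a * word x) q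
    + D (letter a) (letter b) * qsh D (word x) q" for a b x
    by (induction q rule: ncpoly_induct) (simp_all only: 1 simps add_ac)
  have 3: "qsh D (letter a * p) (letter b * q) =
    letter a * qsh D p (letter b * q) + letter b * qsh D (letter a * p) q
    + D (letter a) (letter b) * qsh D p q" for a b
    by (induction p rule: ncpoly_induct) (simp_all only: 2 simps add_ac)
  have 4: "qsh D (letter a * p) (g * q) =
    letter a * qsh D p (g * q) + g * qsh D (letter a * p) q
    + D (letter a) g * qsh D p q" for a
    using assms(2)
    by (induction g rule: letter_span_induct)
      (simp_all only: 3 simps add_ac add_right scale_right letter_span_closed)
  from assms(1) show ?thesis
    by (induction f rule: letter_span_induct)
      (simp_all only: 4 simps add_ac add_left scale_left assms(2))
qed

text \<open>In the recursion for \<open>u p\<close> and \<open>a w\<close>, the diamond term is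
  \<open>- a u (p \<cdot> w)\<close>. It cancels \<open>a (u p \<cdot> w)\<close> by the induction
  hypothesis, and only \<open>u (p \<cdot> a w)\<close> remains.\<close>

lemma qsh_pull_annihilator:
  assumes u: "u \<in> letter_span" and "\<And>a. D (letter a) u = - (letter a * u)"
  shows "qsh D (u * p) q = u * qsh D p q"
proof (induction q rule: ncpoly_induct)
  case (word w)
  show ?case
  proof (induction w)
    case (Cons a w)
    have "D u (letter a) = - (letter a * u)"
      using assms by (metis span_commute letter_span_closed(1))
    then show ?case
      using Cons qsh_span_mult[OF u letter_span_closed(1), of p a "word w"]
      by (simp add: word_Cons[of a w] mult.assoc)
  qed simp
qed (simp_all add: qsh_add_right qsh_scale_right algebra_simps scale_mult_right)

text \<open>
  The right-hand side is symmetric enough that commutativity turns the expansion of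
  \<open>(\<gamma>z \<cdot> \<beta>y) \<cdot> \<alpha>x\<close> into that of \<open>(\<alpha>x \<cdot> \<beta>y) \<cdot> \<gamma>z\<close>.
\<close>

lemma qsh_triple_expand:
  fixes a b c :: 'l and x y z :: "'l list"
  assumes "f \<in> letter_span" "D (letter a) (letter b) = f * w"
    and pull: "\<And>p q. qsh D (w * p) q = w * qsh D p q"
  defines "A \<equiv> word (a # x)" and "B \<equiv> word (b # y)" and "C \<equiv> word (c # z)"
  shows "qsh D (qsh D A B) C =
      letter a * qsh D (qsh D (word x) B) C + letter b * qsh D (qsh D A (word y)) C
    + letter c * qsh D (qsh D A B) (word z)
    + D (letter a) (letter b) * qsh D (qsh D (word x) (word y)) C
    + D (letter a) (letter c) * qsh D (qsh D (word x) B) (word z)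
    + D (letter b) (letter c) * qsh D (qsh D A (word y)) (word z)
    + D f (letter c) * w * qsh D (qsh D (word x) (word y)) (word z)"
proof -
  have words: "A = letter a * word x" "B = letter b * word y" "C = letter c * word z"
    unfolding A_def B_def C_def by (rule word_Cons)+
  have AB: "qsh D A B = letter a * qsh D (word x) B + letter b * qsh D A (word y)
      + f * (w * qsh D (word x) (word y))"
    unfolding words by (subst qsh_span_mult) (simp_all only: letter_span_closed assms(2) mult.assoc)
  have step: "qsh D (g * p) C = g * qsh D p C + letter c * qsh D (g * p) (word z)
      + D g (letter c) * qsh D p (word z)" if "g \<in> letter_span" for g p
    unfolding words by (rule qsh_span_mult[OF that letter_span_closed(1)])
  have "qsh D (qsh D A B) C = qsh D (letter a * qsh D (word x) B) C
      + qsh D (letter b * qsh D A (word y)) C + qsh D (f * (w * qsh D (word x) (word y))) C"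
    unfolding AB qsh_add_left ..
  \<comment> \<open>Each of the three summands of \<open>qsh D A B\<close> contributes a term
    starting with \<open>c\<close> when multiplied by \<open>C\<close>; this equation recombines
    them.\<close>
  moreover have "letter c * qsh D (qsh D A B) (word z) =
      letter c * qsh D (letter a * qsh D (word x) B) (word z)
    + letter c * qsh D (letter b * qsh D A (word y)) (word z)
    + letter c * qsh D (f * (w * qsh D (word x) (word y))) (word z)"
    unfolding AB qsh_add_left distrib_left ..
  ultimately show ?thesis
    unfolding step[OF letter_span_closed(1)] step[OF assms(1)] pull assms(2) mult.assoc
    by (simp only: add_ac)
qed

text \<open>For a commutative product, associativity amounts to invariance of
  \<open>(x \<cdot> y) \<cdot> z\<close> under exchanging \<open>x\<close> and \<open>z\<close>.
  Expanding both sides, all terms match by induction on the total length, and the coefficients of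
  the last ones agree by \<open>assoc\<close> and \<open>sym\<close>.\<close>

lemma qsh_assoc_of_factorization:
  assumes f: "\<And>a b. f a b \<in> letter_span"
    and fact: "\<And>a b. D (letter a) (letter b) = f a b * w a b"
    and pull: "\<And>a b p q. qsh D (w a b * p) q = w a b * qsh D p q"
    and assoc: "\<And>a b c. D (f a b) (letter c) * w a b = D (letter a) (f b c) * w b c"
    and sym: "\<And>a b. f a b = f b a" "\<And>a b. w a b = w b a"
  shows "qsh D (qsh D p q) r = qsh D p (qsh D q r)"
proof -
  note simps = qsh_add_left qsh_add_right qsh_scale_left qsh_scale_right
  have "qsh D (qsh D (word x) (word y)) (word z) = qsh D (qsh D (word z) (word y)) (word x)"
    for x y z
  proof (induction "length x + length y + length z" arbitrary: x y z rule: less_induct)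
    case less
    show ?case
    proof (cases "x = [] \<or> y = [] \<or> z = []")
      case True
      then show ?thesis
        by (auto simp: qsh_commute)
    next
      case False
      then obtain a x' b y' c z' where
        eqs: "x = a # x'" "y = b # y'" "z = c # z'"
        by (auto simp: neq_Nil_conv)
      \<comment> \<open>The associativity condition in reversed form, needed for the last term of
        the expansion.\<close>
      have e: "D (f a b) (letter c) * w a b = D (f c b) (letter a) * w c b"
        unfolding assoc[of a b c] sym[of c b] by (simp add: span_commute f letter_span_closed)
      have IH: "qsh D (qsh D (word x') (word (b # y'))) (word (c # z')) =
            qsh D (qsh D (word (c # z')) (word (b # y'))) (word x')"
          "qsh D (qsh D (word (a # x')) (word y')) (word (c # z')) =
            qsh D (qsh D (word (c # z')) (word y')) (word (a # x'))"
          "qsh D (qsh D (word (a # x')) (word (b # y'))) (word z') =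
            qsh D (qsh D (word z') (word (b # y'))) (word (a # x'))"
          "qsh D (qsh D (word x') (word y')) (word (c # z')) =
            qsh D (qsh D (word (c # z')) (word y')) (word x')"
          "qsh D (qsh D (word x') (word (b # y'))) (word z') =
            qsh D (qsh D (word z') (word (b # y'))) (word x')"
          "qsh D (qsh D (word (a # x')) (word y')) (word z') =
            qsh D (qsh D (word z') (word y')) (word (a # x'))"
          "qsh D (qsh D (word x') (word y')) (word z') =
            qsh D (qsh D (word z') (word y')) (word x')"
        by (rule less; simp add: eqs)+
      show ?thesis
        unfolding eqs
        unfolding qsh_triple_expand[OF f fact pull] e letter_commute[of b a]
          letter_commute[of c a] letter_commute[of c b] IH
        by (simp only: add_ac)
    qed
  qed
  then have w: "qsh D (qsh D (word x) (word y)) (word z) = qsh D (word x) (qsh D (word y) (word z))"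
    for x y z
    by (subst qsh_commute[of "word x" "qsh D (word y) (word z)"], subst qsh_commute[of "word y" "word z"])
  have "qsh D (qsh D (word x) (word y)) r = qsh D (word x) (qsh D (word y) r)" for x y
    by (induction r rule: ncpoly_induct) (simp_all add: w simps)
  then have "qsh D (qsh D (word x) q) r = qsh D (word x) (qsh D q r)" for x
    by (induction q rule: ncpoly_induct) (simp_all add: simps)
  then show ?thesis
    by (induction p rule: ncpoly_induct) (simp_all add: simps)
qed

lemma annihilator_span:
  assumes "u \<in> letter_span" "\<And>a. D (letter a) u = - (letter a * u)" "x \<in> letter_span"
  shows "D x u = - (x * u)"
  using assms(3)
  by (induction x rule: letter_span_induct)
    (simp_all add: assms(1,2) add_left scale_left scale_mult_left algebra_simps)

lemma uminus_right: "x \<in> letter_span \<Longrightarrow> z \<in> letter_span \<Longrightarrow> D z (- x) = - D z x"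
  using scale_right[of x z "- 1"] by simp

end

section \<open>The shape of \<open>\<alpha> \<diamond> \<beta>\<close> for an associative
  \<open>\<diamond>\<close>\<close>

locale associative_diamond = commutative_diamond D
  for D :: "('l, 'r::comm_ring_1) diamond" +
  assumes associative: "diamond_associative D"
begin

abbreviation prd :: "'l \<Rightarrow> 'l \<Rightarrow> ('l, 'r) ncpoly" where
  "prd a b \<equiv> D (letter a) (letter b)"

lemma decomposable:
  "remainder (prd a b) \<notin> letter_span \<Longrightarrow> \<exists>w. remainder (prd a b) = word w"
  using associative by (auto simp: diamond_associative_def diamond_decomposable_def)

lemma first_letter_span: "first_letter (prd a b) \<in> letter_span"
  using associative by (auto simp: diamond_associative_def)

lemma prd_assoc:
  "D (first_letter (prd a b)) (letter c) * remainder (prd a b) =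
    D (letter a) (first_letter (prd b c)) * remainder (prd b c)"
  using associative unfolding diamond_associative_def by blast

lemma long_annihilator:
  "poly_length (prd a b) \<ge> 2 \<Longrightarrow> D (letter c) (first_letter (remainder (prd a b))) =
    - (letter c * first_letter (remainder (prd a b)))"
  using associative unfolding diamond_associative_def by blast

text \<open>\<open>first_letter\<close> preserves the constant term, and its value here lies in the
  span of the letters.\<close>

lemma Nil_notin_prd: "[] \<notin> Poly_Mapping.keys (prd a b)"
  using first_letter_span[of a b] lookup_first_letter_Nil[of "prd a b"]
  by (simp add: letter_span_iff in_keys_iff)

lemma short_prd:
  assumes "\<not> poly_length (prd a b) \<ge> 2"
  shows "prd a b \<in> letter_span"
proof -
  have "length w = 1" if "w \<in> Poly_Mapping.keys (prd a b)" for w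
  proof -
    have "length w \<le> poly_length (prd a b)"
      unfolding poly_length_def using that by (intro Max_ge) auto
    moreover have "w \<noteq> []" using that Nil_notin_prd by auto
    ultimately show ?thesis using assms length_greater_0_conv[of w] by linarith
  qed
  then show ?thesis by (simp add: letter_span_def)
qed

text \<open>Decomposability leaves two cases: a linear remainder is a sum of distinct letters, and
  any other remainder is a single word, whose first letter then forms \<open>V\<close>.\<close>

lemma long_prd:
  assumes "poly_length (prd a b) \<ge> 2"
  obtains V where "finite V" "V \<noteq> {}" "first_letter (remainder (prd a b)) = letter_sum V"
    "remainder (prd a b) = letter_sum V \<or>
      (\<exists>d w. V = {d} \<and> remainder (prd a b) = word (d # w))"
proof -
  \<comment> \<open>The maximum is attained by a word of length at least 2, so the remainder
    contains a non-empty word; this makes \<open>V\<close> non-empty.\<close>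
  have "poly_length (prd a b) \<in> insert 0 (length ` Poly_Mapping.keys (prd a b))"
    unfolding poly_length_def by (rule Max_in) auto
  with assms obtain k where k: "k \<in> Poly_Mapping.keys (prd a b)" "length k \<ge> 2" by auto
  then have k': "drop 1 k \<in> Poly_Mapping.keys (remainder (prd a b))" "drop 1 k \<noteq> []"
    by (auto simp: keys_remainder)
  show ?thesis
  proof (cases "remainder (prd a b) \<in> letter_span")
    case True
    then obtain V where V: "finite V" "remainder (prd a b) = letter_sum V"
      by (rule remainder_in_letter_span)
    moreover have "V \<noteq> {}" using k' V by (auto simp: letter_sum_def)
    ultimately show ?thesis using that[of V] first_letter_letter_span[OF True] by simp
  next
    case False
    then obtain w where w: "remainder (prd a b) = word w" using decomposable by blast
    with k' have "w \<noteq> []" by auto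
    then obtain d v where "w = d # v" by (cases w) auto
    then show ?thesis
      using w by (intro that[of "{d}"]) (auto simp: letter_sum_def first_letter_conv_linear_extension)
  qed
qed

text \<open>Evaluating the diamond product of the two sums in both orders shows that they commute as
  polynomials.\<close>

lemma annihilator_unique:
  assumes "finite V" "V \<noteq> {}" "\<And>a. D (letter a) (letter_sum V) = - (letter a * letter_sum V)"
    and "finite W" "W \<noteq> {}" "\<And>a. D (letter a) (letter_sum W) = - (letter a * letter_sum W)"
  shows "V = W"
proof -
  have "- (letter_sum V * letter_sum W) = - (letter_sum W * letter_sum V :: ('l, 'r) ncpoly)"
    using annihilator_span[OF letter_sum_span assms(3) letter_sum_span, of W]
      annihilator_span[OF letter_sum_span assms(6) letter_sum_span, of V]
      span_commute[OF letter_sum_span[of V] letter_sum_span[of W]] by metis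
  then show ?thesis
    using letter_sum_commute_imp_eq[OF assms(1,2,4,5)] by simp
qed

lemma short_prd_factor:
  assumes "prd a b \<in> letter_span"
  shows "prd a b = first_letter (prd a b) * remainder (prd a b)"
proof (cases "prd a b = 0")
  case False
  then show ?thesis
    using remainder_letter_span[OF assms] first_letter_letter_span[OF assms] by simp
qed (simp add: remainder_def)

lemma short_remainder:
  assumes "prd a b \<in> letter_span"
  shows "remainder (prd a b) \<in> {0, 1}"
  using remainder_letter_span[OF assms] by (cases "prd a b = 0") (auto simp: remainder_def)

lemma pull_short:
  assumes "prd a b \<in> letter_span"
  shows "qsh D (remainder (prd a b) * p) q = remainder (prd a b) * qsh D p q"
  using short_remainder[OF assms] by (auto simp: qsh_conv_linear_extension)

text \<open>
  Sum the associativity condition for \<open>x, y, v\<close> over \<open>v \<in> V\<close>: the products \<open>y \<diamond> v\<close> of length 1 sum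
  to 0, because \<open>y \<diamond> u = - y u\<close> is homogeneous of degree 2, while the others have remainder \<open>u\<close>.
\<close>

lemma sum_assoc_annihilator:
  assumes fin: "finite V" and ann: "\<And>a. D (letter a) (letter_sum V) = - (letter a * letter_sum V)"
    and long: "\<And>a b. poly_length (prd a b) \<ge> 2 \<Longrightarrow> remainder (prd a b) = letter_sum V"
  shows "first_letter (prd x y) * letter_sum V * remainder (prd x y) =
    scale (of_nat (card V)) (prd x y * letter_sum V)"
proof -
  let ?u = "letter_sum V"
  define T where "T v = first_letter (prd y v)" for v
  define V1 where "V1 = {v \<in> V. prd y v \<in> letter_span}"
  have V1: "V1 \<subseteq> V" by (auto simp: V1_def)
  have T: "T v \<in> letter_span" for v by (simp add: T_def first_letter_span)
  have sum_prd: "(\<Sum>v \<in> V. prd y v) = - (letter y * ?u)"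
    using ann[of y] by (simp add: letter_sum_def sum_right letter_span_closed)
  \<comment> \<open>A word \<open>[a]\<close> in \<open>prd y v\<close> would put the empty word
    into the remainder, which is a sum of letters.\<close>
  have lookup_long: "Poly_Mapping.lookup (prd y v) [a] = 0" if "v \<in> V - V1" for v a
  proof (rule ccontr)
    assume "Poly_Mapping.lookup (prd y v) [a] \<noteq> 0"
    then have "[a] \<in> Poly_Mapping.keys (prd y v)" by (simp add: in_keys_iff)
    then have "drop 1 [a] \<in> Poly_Mapping.keys (remainder (prd y v))"
      unfolding keys_remainder by (rule imageI)
    moreover have "remainder (prd y v) = ?u"
      using that short_prd[of y v] long[of y v] by (auto simp: V1_def)
    ultimately show False
      using letter_sum_span[of V, where 'b = 'r] by (auto simp: letter_span_def)
  qed
  \<comment> \<open>The coefficient at \<open>[a]\<close> may be computed from all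
    \<open>prd y v\<close> with \<open>v \<in> V\<close>, whose sum \<open>- y u\<close> contains no
    single letters.\<close>
  have sum_V1: "(\<Sum>v \<in> V1. T v) = 0"
  proof (rule poly_mapping_eqI)
    fix w
    show "Poly_Mapping.lookup (\<Sum>v \<in> V1. T v) w = Poly_Mapping.lookup 0 w"
    proof (cases "length w = 1")
      case True
      then obtain a where w: "w = [a]" by (auto simp: length_Suc_conv)
      have "Poly_Mapping.lookup (\<Sum>v \<in> V1. T v) w = (\<Sum>v \<in> V1. Poly_Mapping.lookup (prd y v) [a])"
        unfolding lookup_sum w
        by (intro sum.cong) (auto simp: T_def V1_def first_letter_letter_span)
      also have "\<dots> = (\<Sum>v \<in> V. Poly_Mapping.lookup (prd y v) [a])"
        using lookup_long by (intro sum.mono_neutral_left fin V1) auto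
      also have "\<dots> = Poly_Mapping.lookup (- (letter y * ?u)) [a]"
        unfolding sum_prd[symmetric] lookup_sum ..
      also have "\<dots> = 0"
        using letter_sum_span[of V, where 'b = 'r]
        by (simp add: lookup_letter_mult letter_span_iff)
      finally show ?thesis by simp
    next
      case False
      then show ?thesis using letter_span_sum[of V1 T] T by (simp add: letter_span_iff)
    qed
  qed
  \<comment> \<open>Each of the \<open>card V\<close> words in \<open>y u\<close> has first letter
    \<open>y\<close>.\<close>
  have sum_T: "(\<Sum>v \<in> V. T v) = - scale (of_nat (card V)) (letter y)"
  proof -
    have "(\<Sum>v \<in> V. T v) = first_letter (\<Sum>v \<in> V. prd y v)"
      by (simp add: T_def first_letter_conv_linear_extension linear_extension_sum)
    also have "\<dots> = - (\<Sum>v \<in> V. first_letter (letter y * letter v))"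
      unfolding sum_prd letter_sum_def sum_distrib_left
      by (simp add: first_letter_conv_linear_extension linear_extension_sum linear_extension_uminus)
    finally show ?thesis by (simp add: first_letter_letter_mult scale_of_nat)
  qed
  have "- (first_letter (prd x y) * ?u * remainder (prd x y)) =
      D (first_letter (prd x y)) ?u * remainder (prd x y)"
    by (simp add: annihilator_span[OF letter_sum_span ann first_letter_span])
  also have "\<dots> = (\<Sum>v \<in> V. D (first_letter (prd x y)) (letter v) * remainder (prd x y))"
    by (simp add: letter_sum_def sum_right first_letter_span letter_span_closed sum_distrib_right)
  also have "\<dots> = (\<Sum>v \<in> V. D (letter x) (T v) * remainder (prd y v))"
    by (simp add: prd_assoc T_def)
  also have "\<dots> = (\<Sum>v \<in> V1. D (letter x) (T v) * remainder (prd y v)) +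
      (\<Sum>v \<in> V - V1. D (letter x) (T v) * remainder (prd y v))"
    using sum.subset_diff[OF V1 fin] by (simp add: add.commute)
  \<comment> \<open>For \<open>v \<in> V1\<close> the remainder is 1, unless
    \<open>prd y v = 0\<close>; but then \<open>T v = 0\<close> as well.\<close>
  also have "(\<Sum>v \<in> V1. D (letter x) (T v) * remainder (prd y v)) = (\<Sum>v \<in> V1. D (letter x) (T v))"
  proof (rule sum.cong)
    fix v assume "v \<in> V1"
    then have "prd y v \<in> letter_span" by (simp add: V1_def)
    then show "D (letter x) (T v) * remainder (prd y v) = D (letter x) (T v)"
      using remainder_letter_span[of "prd y v"]
      by (cases "prd y v = 0")
        (auto simp: T_def first_letter_conv_linear_extension zero_right letter_span_closed)
  qed simp
  also have "\<dots> = 0"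
    by (simp add: sum_right[symmetric] T letter_span_closed sum_V1 zero_right)
  also have "(\<Sum>v \<in> V - V1. D (letter x) (T v) * remainder (prd y v)) =
      (\<Sum>v \<in> V - V1. D (letter x) (T v) * ?u)"
  proof (rule sum.cong)
    fix v assume "v \<in> V - V1"
    then have "remainder (prd y v) = ?u"
      using short_prd[of y v] long[of y v] by (auto simp: V1_def)
    then show "D (letter x) (T v) * remainder (prd y v) = D (letter x) (T v) * ?u" by simp
  qed simp
  also have "\<dots> = D (letter x) (\<Sum>v \<in> V - V1. T v) * ?u"
    by (simp add: sum_right T letter_span_closed sum_distrib_right)
  also have "(\<Sum>v \<in> V - V1. T v) = (\<Sum>v \<in> V. T v)"
    using sum.subset_diff[OF V1 fin, of T] sum_V1 by simp
  also have "D (letter x) (\<Sum>v \<in> V. T v) * ?u = - scale (of_nat (card V)) (prd x y * ?u)"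
    unfolding sum_T by (simp add: uminus_right scale_right letter_span_closed scale_mult_left)
  finally show ?thesis by simp
qed

text \<open>The equation \<open>d # w = w @ [d]\<close> forces \<open>w\<close> to be a power of
  \<open>d\<close>, so its letters can be pulled out one by one.\<close>

lemma pull_power_of_annihilator:
  assumes "\<And>a. D (letter a) (letter d) = - (letter a * letter d)" "d # w = w @ [d]"
  shows "qsh D (word w * p) q = word w * qsh D p q"
  using assms(2)
proof (induction w arbitrary: p)
  case (Cons e w)
  then have "e = d" "d # w = w @ [d]" by auto
  show ?case
    unfolding \<open>e = d\<close> word_Cons[of d w] mult.assoc
      qsh_pull_annihilator[OF letter_span_closed(1) assms(1)] Cons.IH[OF \<open>d # w = w @ [d]\<close>] ..
qed simp

text \<open>Since \<open>prd b d = - b d\<close> has first letter part \<open>- b\<close> and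
  remainder \<open>d\<close>, associativity for \<open>a, b, d\<close> reads
  \<open>F d w = F w d\<close> with \<open>F = first_letter (prd a b)\<close>. Comparing
  coefficients at \<open>e d w\<close>, for a letter \<open>e\<close> occurring in \<open>F\<close>,
  gives the claim.\<close>

lemma word_remainder_power:
  assumes ann: "\<And>a. D (letter a) (letter d) = - (letter a * letter d)"
    and R: "remainder (prd a b) = word w"
  shows "d # w = w @ [d]"
proof -
  let ?F = "first_letter (prd a b)"
  have prd: "prd a b = ?F * word w"
    by (rule first_letter_mult_remainder_word[OF Nil_notin_prd R])
  have "prd b d = - word [b, d]" using ann by (simp add: word_Cons[of b "[d]"])
  then have "first_letter (prd b d) = - letter b" "remainder (prd b d) = letter d"
    by (simp_all add: remainder_uminus first_letter_conv_linear_extension linear_extension_uminus)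
  then have "- (?F * letter d) * word w = - (prd a b * letter d)"
    using prd_assoc[of a b d] R annihilator_span[OF letter_span_closed(1) ann first_letter_span]
    by (simp add: uminus_right letter_span_closed)
  then have eq: "?F * word (d # w) = ?F * word (w @ [d])"
    by (subst (asm) (2) prd) (simp add: word_Cons[of d w] word_append mult.assoc)
  have "?F \<noteq> 0"
  proof
    assume "?F = 0"
    with prd have "prd a b = 0" by simp
    with R have "word w = (0 :: ('l, 'r) ncpoly)" by (simp add: remainder_def)
    then show False using keys_word[of w, where 'r = 'r] by simp
  qed
  then obtain v where "Poly_Mapping.lookup ?F v \<noteq> 0"
    by (metis poly_mapping_eqI lookup_zero)
  then obtain e where "Poly_Mapping.lookup ?F [e] \<noteq> 0"
    using first_letter_span[of a b] by (cases "length v = 1") (auto simp: letter_span_iff length_Suc_conv)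
  then show ?thesis
    using arg_cong[OF eq, of "\<lambda>p. Poly_Mapping.lookup p (e # d # w)"]
    by (auto simp: lookup_letter_span_mult first_letter_span lookup_word when_def split: if_splits)
qed

text \<open>A single scalar \<open>c\<close> serves all pairs of letters, so the associativity
  equation survives replacing \<open>F(\<alpha> \<diamond> \<beta>)\<close> by its multiple by
  \<open>c\<close>.\<close>

lemma prd_factorization:
  assumes inverse: "\<And>n. n > 0 \<Longrightarrow> \<exists>i. of_nat n * i = (1 :: 'r)"
  obtains c where "\<And>a b. prd a b = scale c (first_letter (prd a b)) * remainder (prd a b)"
    and "\<And>a b p q. qsh D (remainder (prd a b) * p) q = remainder (prd a b) * qsh D p q"
proof (cases "\<forall>a b. prd a b \<in> letter_span")
  case True
  then show ?thesis
    using that[of 1] short_prd_factor pull_short by simp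
next
  case False
  \<comment> \<open>One product of length at least 2 fixes \<open>V\<close>;
    \<open>annihilator_unique\<close> transfers it to all others.\<close>
  then obtain a0 b0 where 0: "poly_length (prd a0 b0) \<ge> 2" using short_prd by blast
  obtain V where V: "finite V" "V \<noteq> {}" "first_letter (remainder (prd a0 b0)) = letter_sum V"
    using long_prd[OF 0] by metis
  have ann: "D (letter a) (letter_sum V) = - (letter a * letter_sum V)" for a
    using long_annihilator[OF 0, of a] by (simp add: V)
  have long: "remainder (prd a b) = letter_sum V \<or>
      (\<exists>d w. V = {d} \<and> remainder (prd a b) = word (d # w))" if ab: "poly_length (prd a b) \<ge> 2" for a b
  proof -
    obtain W where W: "finite W" "W \<noteq> {}" "first_letter (remainder (prd a b)) = letter_sum W"
      "remainder (prd a b) = letter_sum W \<or>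
      (\<exists>d w. W = {d} \<and> remainder (prd a b) = word (d # w))"
      by (rule long_prd[OF ab])
    have "V = W"
      using V W(1,2) ann long_annihilator[OF ab, unfolded W(3)] by (intro annihilator_unique)
    then show ?thesis using W(4) by simp
  qed
  show ?thesis
  proof (cases "\<exists>d. V = {d}")
    case True
    then obtain d where d: "V = {d}" by blast
    then have u: "letter_sum V = letter d" by (simp add: letter_sum_def)
    have long_word: "\<exists>w. remainder (prd a b) = word w" if "prd a b \<notin> letter_span" for a b
      using long[of a b] short_prd[of a b] that u by metis
    show ?thesis
    proof (rule that[of 1])
      fix a b
      show "prd a b = scale 1 (first_letter (prd a b)) * remainder (prd a b)"
      proof (cases "prd a b \<in> letter_span")
        case True
        then show ?thesis using short_prd_factor by simp
      next
        case False
        then obtain w where w: "remainder (prd a b) = word w" using long_word by blast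
        show ?thesis
          using first_letter_mult_remainder_word[OF Nil_notin_prd w] w by simp
      qed
    next
      fix a b p q
      show "qsh D (remainder (prd a b) * p) q = remainder (prd a b) * qsh D p q"
      proof (cases "prd a b \<in> letter_span")
        case False
        then obtain w where w: "remainder (prd a b) = word w" using long_word by blast
        note ann' = ann[unfolded u]
        show ?thesis
          unfolding w
          by (rule pull_power_of_annihilator[OF ann' word_remainder_power[OF ann' w]])
      qed (rule pull_short)
    qed
  next
    case False
    define m where "m = card V"
    \<comment> \<open>Both \<open>m\<close> and \<open>m - 1\<close> are thus positive and
      invertible in the ring.\<close>
    have "m > 1"
      using V(1,2) False by (metis m_def card_gt_0_iff card_1_singleton_iff less_one nat_neq_iff One_nat_def)
    then obtain i j where i: "of_nat m * i = (1 :: 'r)" and j: "of_nat (m - 1) * j = (1 :: 'r)"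
      using inverse[of m] inverse[of "m - 1"] by auto
    have long': "remainder (prd a b) = letter_sum V" if "poly_length (prd a b) \<ge> 2" for a b
      using long[OF that] False by blast
    note key = sum_assoc_annihilator[OF V(1) ann long', folded m_def]
    note cancel = mult_letter_sum_eq_0[OF V(1,2)]
    \<comment> \<open>For a non-zero \<open>p = prd a b\<close> in the span, \<open>F(p) = p\<close>
      and \<open>R(p) = 1\<close>, so \<open>key\<close> becomes \<open>p u = m p u\<close>, whence
      \<open>(m - 1) p u = 0\<close>.\<close>
    have short_0: "prd a b = 0" if short: "prd a b \<in> letter_span" for a b
    proof (rule ccontr)
      assume "prd a b \<noteq> 0"
      then have "prd a b * letter_sum V = scale (of_nat m) (prd a b * letter_sum V)"
        using key[of a b] by (simp add: remainder_letter_span[OF short] first_letter_letter_span[OF short])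
      moreover have "of_nat m = of_nat (m - 1) + (1 :: 'r)"
        using \<open>m > 1\<close> by (simp add: of_nat_diff)
      ultimately have "scale (of_nat (m - 1)) (prd a b * letter_sum V) = 0"
        by (simp add: scale.scale_left_distrib)
      then have "scale (j * of_nat (m - 1)) (prd a b * letter_sum V) = 0"
        by (simp flip: scale.scale_scale)
      then have "prd a b * letter_sum V = 0"
        using j by (simp add: mult.commute)
      then show False
        using cancel \<open>prd a b \<noteq> 0\<close> by blast
    qed
    \<comment> \<open>The scalar is \<open>i\<close>, the inverse of \<open>m\<close>: cancelling
      \<open>u\<close> on the right in \<open>key\<close> gives \<open>F(p) u = m p\<close> for the
      long products \<open>p\<close>.\<close>
    show ?thesis
    proof (rule that[of i])
      fix a b
      show "prd a b = scale i (first_letter (prd a b)) * remainder (prd a b)"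
      proof (cases "prd a b \<in> letter_span")
        case True
        then show ?thesis using short_0[OF True] by (simp add: remainder_def)
      next
        case False
        then have R: "remainder (prd a b) = letter_sum V" using short_prd long' by blast
        have "(first_letter (prd a b) * letter_sum V - scale (of_nat m) (prd a b)) * letter_sum V = 0"
          using key[of a b] by (simp only: R left_diff_distrib scale_mult_left) simp
        then have "first_letter (prd a b) * letter_sum V = scale (of_nat m) (prd a b)"
          using cancel[of "first_letter (prd a b) * letter_sum V - scale (of_nat m) (prd a b)"]
          by (simp only: right_minus_eq)
        then have "scale i (first_letter (prd a b)) * letter_sum V = scale (i * of_nat m) (prd a b)"
          by (simp only: scale_mult_left scale.scale_scale)
        also have "i * of_nat m = 1" using i by (simp only: mult.commute)
        finally show ?thesis by (simp only: R scale.scale_one)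
      qed
    next
      fix a b p q
      show "qsh D (remainder (prd a b) * p) q = remainder (prd a b) * qsh D p q"
      proof (cases "prd a b \<in> letter_span")
        case False
        then have "remainder (prd a b) = letter_sum V" using short_prd long' by blast
        then show ?thesis using qsh_pull_annihilator[OF letter_sum_span ann] by simp
      qed (rule pull_short)
    qed
  qed
qed

end

theorem theorem3p13:
  fixes \<iota> :: "rat \<Rightarrow> 'r::comm_ring_1"
    and D :: "('l, 'r) diamond"
  assumes "rat_embedding \<iota>"
    and "diamond_bilinear D"
    and "diamond_commutative D"
    and "diamond_associative D"
  shows "commutative_algebra scale (qsh D) (word [])"
proof -
  interpret associative_diamond D
    by standard (use assms in auto)
  have "\<exists>i. of_nat n * i = (1 :: 'r)" if "n > 0" for n
    using rat_embedding_of_nat_inverse[OF assms(1) that] by blast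
  then obtain c where
    fact: "\<And>a b. prd a b = scale c (first_letter (prd a b)) * remainder (prd a b)" and
    pull: "\<And>a b p q. qsh D (remainder (prd a b) * p) q = remainder (prd a b) * qsh D p q"
    using prd_factorization by blast
  have assoc: "qsh D (qsh D p q) r = qsh D p (qsh D q r)" for p q r
  \<comment> \<open>Here \<open>f a b\<close> is \<open>scale c (first_letter (prd a b))\<close> and
    \<open>w a b\<close> is \<open>remainder (prd a b)\<close>.\<close>
  proof (rule qsh_assoc_of_factorization[OF _ fact pull])
    show "D (scale c (first_letter (prd a b))) (letter e) * remainder (prd a b) =
        D (letter a) (scale c (first_letter (prd b e))) * remainder (prd b e)" for a b e
      by (simp add: scale_left scale_right first_letter_span letter_span_closed scale_mult_left prd_assoc)
  qed (simp_all add: first_letter_span letter_span_closed letter_commute)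
  show ?thesis
  proof
    show "qsh D (qsh D p q) r = qsh D p (qsh D q r)" for p q r by (rule assoc)
    show "qsh D p q = qsh D q p" for p q by (rule qsh_commute)
  qed (simp_all add: qsh_add_left qsh_scale_left)
qed

end
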